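(* Let $0<q<1$, $0<\alpha<\frac n2$, $\frac{n}{n-2\alpha}<r<\infty$, and let $\sigma$ be a nonnegative measurable function on $\mathbb{R}^n$, $\sigma\not\equiv0$, such that $$\sigma\in L^{s_2}(\mathbb{R}^n),\qquad s_2=\frac{nr}{n(1-q)+2\alpha r}.$$ Then there exists a positive solution $u\in L^r(\mathbb{R}^n)$ to the problem $$(-\Delta)^\alpha u=\sigma u^q,\quad u\ge0\ \text{ in }\mathbb{R}^n,\qquad\liminf_{x\to\infty}u(x)=0.$$
   Context: The function $\sigma$ is identified with the measure $d\sigma=\sigma\,dx$; $\sigma\not\equiv 0$ means this measure is nonzero. For a nonnegative Radon measure $\mu$ on $\mathbb{R}^n$, $\mathbf{I}_{2\alpha}\mu(x)=\int_{\mathbb{R}^n}|x-y|^{2\alpha-n}\,d\mu(y)$ is the Riesz potential of order $2\alpha$ (up to a positive normalization constant, which is immaterial here). A solution $u\ge0$ to the problem is understood in the sense that $u\in L^q_{loc}(\mathbb{R}^n,d\sigma)$ satisfies the integral equation $u=\mathbf{I}_{2\alpha}(u^q\,d\sigma)$ in $\mathbb{R}^n$. *)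

theory Defs
  imports "HOL-Analysis.Analysis"
begin

text \<open>
  Real powers on \<open>[0,\<infinity>]\<close>, for positive exponents: \<open>\<infinity>\<^sup>p = \<infinity>\<close> and \<open>0\<^sup>p = 0\<close>.
\<close>
definition ennreal_powr :: "ennreal \<Rightarrow> real \<Rightarrow> ennreal"  (infixr "epowr" 80)
  where "x epowr p = (if x = \<infinity> then \<infinity> else ennreal (enn2real x powr p))"

definition Lp_space :: "real \<Rightarrow> 'a measure \<Rightarrow> ('a \<Rightarrow> ennreal) set"
  where "Lp_space p M = {f \<in> borel_measurable M. (\<integral>\<^sup>+x. f x epowr p \<partial>M) < \<infinity>}"

definition Lp_loc_space :: "real \<Rightarrow> 'a::topological_space measure \<Rightarrow> ('a \<Rightarrow> ennreal) set"
  where "Lp_loc_space p M =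
    {f \<in> borel_measurable M. \<forall>K. compact K \<longrightarrow> (\<integral>\<^sup>+x\<in>K. f x epowr p \<partial>M) < \<infinity>}"

text \<open>
  The Riesz kernel \<open>|x - y|\<^bsup>\<beta>-n\<^esup>\<close> of order \<open>\<beta> < n\<close>. It is \<open>\<infinity>\<close> on the diagonal, whereas
  \<^term>\<open>0 powr a\<close> is \<open>0\<close> for every real \<^term>\<open>a\<close>.
\<close>
definition riesz_kernel :: "real \<Rightarrow> real ^ 'n \<Rightarrow> real ^ 'n \<Rightarrow> ennreal"
  where "riesz_kernel \<beta> x y =
    (if x = y then \<infinity> else ennreal (norm (x - y) powr (\<beta> - real CARD('n))))"

definition riesz_potential :: "real \<Rightarrow> (real ^ 'n) measure \<Rightarrow> real ^ 'n \<Rightarrow> ennreal"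
  where "riesz_potential \<beta> \<mu> x = (\<integral>\<^sup>+y. riesz_kernel \<beta> x y \<partial>\<mu>)"

definition weight_measure :: "(real ^ 'n \<Rightarrow> real) \<Rightarrow> (real ^ 'n) measure"
  where "weight_measure \<sigma> = density lebesgue (\<lambda>x. ennreal (\<sigma> x))"

text \<open>
  Solutions of \<open>(-\<Delta>)\<^sup>\<alpha> u = \<sigma> u\<^sup>q\<close>, \<open>u \<ge> 0\<close> in \<open>\<real>\<^sup>n\<close>, with \<open>liminf u(x) = 0\<close> as \<open>x \<rightarrow> \<infinity>\<close>. The equation
  is understood as the integral equation \<open>u = I\<^bsub>2\<alpha>\<^esub>(u\<^sup>q d\<sigma>)\<close>. A solution takes values in \<open>[0,\<infinity>]\<close>,
  and the integral equation is required at every point, both sides being possibly infinite.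
\<close>
definition frac_laplace_solution ::
    "real \<Rightarrow> real \<Rightarrow> (real ^ 'n \<Rightarrow> real) \<Rightarrow> (real ^ 'n \<Rightarrow> ennreal) \<Rightarrow> bool"
  where "frac_laplace_solution \<alpha> q \<sigma> u \<longleftrightarrow>
    u \<in> Lp_loc_space q (weight_measure \<sigma>) \<and>
    (\<forall>x. u x = riesz_potential (2 * \<alpha>) (density (weight_measure \<sigma>) (\<lambda>y. u y epowr q)) x) \<and>
    Liminf at_infinity u = 0"

end

theory Submission
  imports Defs
begin

text \<open>
  Write \<open>\<beta> = 2\<alpha>\<close>, \<open>T u = I\<^sub>\<beta>(\<sigma> u\<^sup>q)\<close> for the nonlinear potential operator, and let \<open>1/p = 1/r + \<beta>/n\<close>. The
  solution is the limit of an increasing sequence of subsolutions \<open>u \<le> T u\<close>, and everything rests on an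
  \<open>L\<^sup>r\<close> bound that is uniform over all subsolutions that lie in \<open>L\<^sup>r\<close>.

  The exponent \<open>s\<^sub>2\<close> is the one for which \<open>1/p = 1/s\<^sub>2 + q/r\<close>, so that \<open>\<sigma> u\<^sup>q\<close> lies in \<open>L\<^sup>p\<close> whenever \<open>u\<close>
  lies in \<open>L\<^sup>r\<close>, while \<open>u\<^bsup>r-1\<^esup>\<close> lies in \<open>L\<^sup>t\<close> with \<open>t = r/(r-1)\<close>. These exponents satisfy
  \<open>1/t + 1/p = 1 + \<beta>/n\<close>, the Hardy-Littlewood-Sobolev relation, so that the double integral of
  \<open>u(x)\<^bsup>r-1\<^esup> |x-y|\<^bsup>\<beta>-n\<^esup> \<sigma>(y) u(y)\<^sup>q\<close> is controlled (\<open>riesz_kernel_bilinear_le\<close>). For a subsolution this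
  integral is at least \<open>\<integral> u\<^sup>r\<close>, and it is homogeneous of degree \<open>r - 1 + q < r\<close> in \<open>u\<close>. Comparing
  degrees after normalizing \<open>u\<close> in \<open>L\<^sup>r\<close> therefore bounds \<open>\<integral> u\<^sup>r\<close> by a constant (\<open>subsolution_Lp_bound\<close>).

  The bilinear inequality has a short proof that uses neither maximal functions nor interpolation. If
  \<open>h \<le> b\<close>, splitting the potential of \<open>h\<close> at the radius \<open>b\<^bsup>-t/n\<^esup>\<close> and using \<open>h \<le> b\<close> near the pole and
  Young's inequality away from it gives the pointwise bound \<open>I\<^sub>\<beta> h \<le> C b\<^bsup>1-\<beta>t/n\<^esup>\<close>, where \<open>C\<close> depends on
  \<open>h\<close> through \<open>\<integral> h\<^sup>t\<close> only (\<open>riesz_potential_le_of_bounded\<close>). Now split the double integral of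
  \<open>f(x) |x-y|\<^bsup>\<beta>-n\<^esup> h(y)\<close> according to whether \<open>h(y) \<le> f(x)\<^bsup>p/t\<^esup>\<close>. On the first part apply this bound
  in \<open>y\<close> with \<open>b = f(x)\<^bsup>p/t\<^esup>\<close>; the exponents combine to give exactly \<open>\<integral> f\<^sup>p\<close>. The second part is the same
  with the roles of \<open>f\<close> and \<open>h\<close> exchanged.

  The iteration starts from \<open>c\<close> times the indicator of a ball that carries some of the mass of \<open>\<sigma>\<close>. On this
  ball the kernel is bounded below, and since \<open>q < 1\<close> the factor \<open>c\<^sup>q\<close> outweighs \<open>c\<close> for small \<open>c\<close>; so
  this is a subsolution. The iterates are \<open>T u\<^sub>k\<close>, cut off in size and in support at
  levels that increase with \<open>k\<close>. The cut-off makes \<open>\<integral> u\<^sub>k\<^sup>r\<close> finite, which the a priori bound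
  presupposes. In the limit the cut-off disappears, and monotone convergence
  gives \<open>u = T u\<close> at every point with \<open>u\<close> in \<open>L\<^sup>r\<close>. Positivity is inherited from \<open>T u\<^sub>0\<close>. Integrability of
  \<open>\<sigma> u\<^sup>q\<close> on bounded sets follows from finiteness of \<open>T u\<close> at a single point, and \<open>liminf u = 0\<close> at infinity
  from \<open>u\<close> being in \<open>L\<^sup>r\<close>.
\<close>

section \<open>Powers of extended nonnegative reals\<close>

lemma epowr_ennreal: "0 \<le> x \<Longrightarrow> ennreal x epowr p = ennreal (x powr p)"
  by (simp add: ennreal_powr_def)

lemma epowr_top [simp]: "top epowr p = top"
  by (simp add: ennreal_powr_def)

lemma epowr_zero [simp]: "0 epowr p = 0"
  by (simp add: ennreal_powr_def)

lemma epowr_one [simp]: "x epowr 1 = x"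
  by (cases x) (auto simp: epowr_ennreal)

lemma epowr_measurable [measurable]: "(\<lambda>x. x epowr p) \<in> borel_measurable borel"
  unfolding ennreal_powr_def by measurable

lemma epowr_mono: "x \<le> y \<Longrightarrow> 0 < p \<Longrightarrow> x epowr p \<le> y epowr p"
  by (cases x; cases y) (auto simp: epowr_ennreal powr_mono2 top_unique intro!: ennreal_leI)

lemma epowr_mult: "0 < p \<Longrightarrow> (x * y) epowr p = x epowr p * y epowr p"
  by (cases x; cases y)
    (auto simp: epowr_ennreal powr_mult ennreal_mult_top ennreal_top_mult
      simp flip: ennreal_mult)

lemma epowr_epowr: "(x epowr a) epowr b = x epowr (a * b)"
  by (cases x) (auto simp: epowr_ennreal powr_powr)

lemma epowr_add: "x epowr (a + b) = x epowr a * x epowr b"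
  by (cases x) (auto simp: epowr_ennreal powr_add ennreal_mult)

text \<open>
  For \<open>p > 0\<close> the power is an order isomorphism of \<open>[0,\<infinity>]\<close> with inverse the power \<open>1/p\<close>, so it commutes
  with every supremum.
\<close>

lemma epowr_SUP:
  assumes "0 < p"
  shows "(SUP i\<in>I. f i) epowr p = (SUP i\<in>I. f i epowr p)"
proof (rule antisym)
  let ?m = "SUP i\<in>I. f i epowr p"
  have "f i \<le> ?m epowr (1 / p)" if "i \<in> I" for i
  proof -
    have "(f i epowr p) epowr (1 / p) \<le> ?m epowr (1 / p)"
      using assms that by (intro epowr_mono SUP_upper) auto
    then show ?thesis using assms by (simp add: epowr_epowr)
  qed
  then have "(SUP i\<in>I. f i) epowr p \<le> (?m epowr (1 / p)) epowr p"
    using assms by (intro epowr_mono SUP_least) auto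
  then show "(SUP i\<in>I. f i) epowr p \<le> ?m"
    using assms by (simp add: epowr_epowr)
  show "?m \<le> (SUP i\<in>I. f i) epowr p"
    using assms by (intro SUP_least epowr_mono SUP_upper)
qed

text \<open>
  A form of Young's inequality in which the constants do not matter: bound \<open>x\<close> and \<open>y\<close> by powers of
  \<open>m = max (x\<^sup>a) (y\<^sup>b)\<close>; the exponents add up to \<open>1\<close>, so the product is at most \<open>m\<close>. With \<open>e = d = p = 1\<close>
  it replaces the usual inequality for conjugate exponents. The general case also covers \<open>s u\<^sup>q\<close> in \<open>L\<^sup>p\<close>.
\<close>

lemma epowr_prod_le_sum:
  assumes "0 < a" "0 < b" "0 < e" "0 < d" "0 < p" and "p * (e / a + d / b) = 1"
  shows "(x epowr e * y epowr d) epowr p \<le> x epowr a + y epowr b"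
proof -
  let ?m = "max (x epowr a) (y epowr b)"
  have "(x epowr a) epowr (e / a) \<le> ?m epowr (e / a)"
       "(y epowr b) epowr (d / b) \<le> ?m epowr (d / b)"
    using assms by (auto intro!: epowr_mono)
  then have "x epowr e \<le> ?m epowr (e / a)" "y epowr d \<le> ?m epowr (d / b)"
    using assms by (auto simp: epowr_epowr)
  then have "x epowr e * y epowr d \<le> ?m epowr (e / a) * ?m epowr (d / b)"
    by (rule mult_mono) auto
  then have "(x epowr e * y epowr d) epowr p \<le> (?m epowr (e / a + d / b)) epowr p"
    using assms by (intro epowr_mono) (auto simp: epowr_add)
  also have "\<dots> = ?m"
    using assms by (simp add: epowr_epowr mult.commute)
  also have "\<dots> \<le> x epowr a + y epowr b"
    by (simp add: add_increasing add_increasing2)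
  finally show ?thesis .
qed

section \<open>Integrals of powers of the distance\<close>

text \<open>
  Sum over the dyadic shells \<open>\<rho>\<mu>\<^sup>i/2 \<le> dist x y < \<rho>\<mu>\<^sup>i\<close>. The contribution of each shell is at most a
  constant times \<open>(\<rho>\<mu>\<^sup>i)\<^bsup>n-\<gamma>\<^esup>\<close>, a geometric sequence of ratio \<open>\<mu>\<^bsup>n-\<gamma>\<^esup>\<close>. Taking \<open>\<mu> = 1/2\<close> treats the
  singularity at \<open>x\<close>, and \<open>\<mu> = 2\<close> the decay at infinity.
\<close>

lemma nn_integral_dist_powr_geometric:
  fixes x :: "'a::euclidean_space" and \<gamma> \<mu> \<rho> :: real
  assumes "0 < \<gamma>" "0 < \<mu>" and m: "\<mu> powr (real DIM('a) - \<gamma>) < 1" and "0 < \<rho>"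
    and cover: "\<And>y. y \<in> S \<Longrightarrow> y \<noteq> x \<Longrightarrow> \<exists>i::nat. \<rho> * \<mu> ^ i / 2 \<le> dist x y \<and> dist x y < \<rho> * \<mu> ^ i"
  shows "(\<integral>\<^sup>+y\<in>S. ennreal (dist x y powr - \<gamma>) \<partial>lborel)
    \<le> ennreal (2 powr \<gamma> * unit_ball_vol DIM('a) / (1 - \<mu> powr (real DIM('a) - \<gamma>))
        * \<rho> powr (real DIM('a) - \<gamma>))"
proof -
  let ?n = "real DIM('a)" and ?V = "unit_ball_vol DIM('a)"
  let ?t = "\<lambda>i. ennreal ((\<rho> * \<mu> ^ i / 2) powr - \<gamma>)"
  let ?c = "2 powr \<gamma> * ?V * \<rho> powr (?n - \<gamma>)"
  have le_suminf: "F i \<le> suminf F" for F :: "nat \<Rightarrow> ennreal" and i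
    using sum_le_suminf[of F "{i}"] by simp
  have pt: "ennreal (dist x y powr - \<gamma>) * indicator S y
      \<le> (\<Sum>i. ?t i * indicator (ball x (\<rho> * \<mu> ^ i)) y)" for y
  proof (cases "y \<in> S \<and> y \<noteq> x")
    case True
    then obtain i :: nat where i: "\<rho> * \<mu> ^ i / 2 \<le> dist x y" "dist x y < \<rho> * \<mu> ^ i"
      using cover by blast
    have "dist x y powr - \<gamma> \<le> (\<rho> * \<mu> ^ i / 2) powr - \<gamma>"
      using i assms by (intro powr_mono2') auto
    then have "ennreal (dist x y powr - \<gamma>) * indicator S y
        \<le> ?t i * indicator (ball x (\<rho> * \<mu> ^ i)) y"
      using True i by (auto intro!: ennreal_leI)
    also have "\<dots> \<le> (\<Sum>i. ?t i * indicator (ball x (\<rho> * \<mu> ^ i)) y)"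
      by (rule le_suminf)
    finally show ?thesis .
  qed auto
  have term_eq: "(\<rho> * \<mu> ^ i / 2) powr - \<gamma> * (?V * (\<rho> * \<mu> ^ i) ^ DIM('a))
      = ?c * (\<mu> powr (?n - \<gamma>)) ^ i" for i
  proof -
    have 1: "(\<rho> * \<mu> ^ i / 2) powr - \<gamma> = 2 powr \<gamma> * (\<rho> * \<mu> ^ i) powr - \<gamma>"
      using assms(1-4) by (simp add: powr_divide powr_minus divide_simps)
    have 2: "(\<rho> * \<mu> ^ i) ^ DIM('a) = (\<rho> * \<mu> ^ i) powr ?n"
      using assms(1-4) by (simp add: powr_realpow)
    have 3: "(\<rho> * \<mu> ^ i) powr - \<gamma> * (\<rho> * \<mu> ^ i) powr ?n
        = \<rho> powr (?n - \<gamma>) * (\<mu> powr (?n - \<gamma>)) ^ i"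
    proof -
      have "(\<rho> * \<mu> ^ i) powr - \<gamma> * (\<rho> * \<mu> ^ i) powr ?n = (\<rho> * \<mu> ^ i) powr (?n - \<gamma>)"
        by (simp flip: powr_add)
      also have "\<dots> = \<rho> powr (?n - \<gamma>) * (\<mu> ^ i) powr (?n - \<gamma>)"
        using assms(1-4) by (simp add: powr_mult)
      also have "(\<mu> ^ i) powr (?n - \<gamma>) = (\<mu> powr (?n - \<gamma>)) ^ i"
        using assms(1-4) by (simp add: powr_powr mult.commute flip: powr_realpow)
      finally show ?thesis .
    qed
    have "(\<rho> * \<mu> ^ i / 2) powr - \<gamma> * (?V * (\<rho> * \<mu> ^ i) ^ DIM('a))
        = 2 powr \<gamma> * ?V * ((\<rho> * \<mu> ^ i) powr - \<gamma> * (\<rho> * \<mu> ^ i) powr ?n)"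
      unfolding 1 2 by (simp only: mult_ac)
    also have "\<dots> = ?c * (\<mu> powr (?n - \<gamma>)) ^ i"
      unfolding 3 by (simp only: mult_ac)
    finally show ?thesis .
  qed
  have "(\<integral>\<^sup>+y\<in>S. ennreal (dist x y powr - \<gamma>) \<partial>lborel)
      \<le> (\<integral>\<^sup>+y. (\<Sum>i. ?t i * indicator (ball x (\<rho> * \<mu> ^ i)) y) \<partial>lborel)"
    by (intro nn_integral_mono pt)
  also have "\<dots> = (\<Sum>i. \<integral>\<^sup>+y. ?t i * indicator (ball x (\<rho> * \<mu> ^ i)) y \<partial>lborel)"
    by (intro nn_integral_suminf borel_measurable_times_ennreal borel_measurable_const
        borel_measurable_indicator) simp
  also have "\<dots> = (\<Sum>i. ennreal (?c * (\<mu> powr (?n - \<gamma>)) ^ i))"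
  proof (rule suminf_cong)
    fix i
    have "(\<integral>\<^sup>+y. ?t i * indicator (ball x (\<rho> * \<mu> ^ i)) y \<partial>lborel)
        = ?t i * ennreal (?V * (\<rho> * \<mu> ^ i) ^ DIM('a))"
      using assms(1-4) by (subst nn_integral_cmult_indicator) (auto simp: emeasure_ball)
    also have "\<dots> = ennreal ((\<rho> * \<mu> ^ i / 2) powr - \<gamma> * (?V * (\<rho> * \<mu> ^ i) ^ DIM('a)))"
      using assms(1-4) by (intro ennreal_mult[symmetric]) auto
    finally show "(\<integral>\<^sup>+y. ?t i * indicator (ball x (\<rho> * \<mu> ^ i)) y \<partial>lborel)
        = ennreal (?c * (\<mu> powr (?n - \<gamma>)) ^ i)"
      unfolding term_eq .
  qed
  also have "\<dots> = ennreal (\<Sum>i. ?c * (\<mu> powr (?n - \<gamma>)) ^ i)"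
  proof (rule suminf_ennreal2)
    show "0 \<le> ?c * (\<mu> powr (?n - \<gamma>)) ^ i" for i by simp
    show "summable (\<lambda>i. ?c * (\<mu> powr (?n - \<gamma>)) ^ i)"
      using m by (intro summable_mult summable_geometric) simp
  qed
  also have "(\<Sum>i. ?c * (\<mu> powr (?n - \<gamma>)) ^ i) = ?c * (1 / (1 - \<mu> powr (?n - \<gamma>)))"
    using m by (subst suminf_mult) (simp_all add: suminf_geometric summable_geometric)
  also have "\<dots> = 2 powr \<gamma> * ?V / (1 - \<mu> powr (?n - \<gamma>)) * \<rho> powr (?n - \<gamma>)"
    by (simp only: times_divide_eq_left times_divide_eq_right mult_1_right)
  finally show ?thesis .
qed

lemma nn_integral_dist_powr_ball:
  assumes "0 < \<gamma>" "\<gamma> < real DIM('a::euclidean_space)"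
  obtains C where "0 \<le> C"
    "\<And>(x::'a) \<rho>. 0 < \<rho> \<Longrightarrow> (\<integral>\<^sup>+y\<in>ball x \<rho>. ennreal (dist x y powr - \<gamma>) \<partial>lborel)
      \<le> ennreal (C * \<rho> powr (real DIM('a) - \<gamma>))"
proof -
  let ?n = "real DIM('a)"
  have m: "(1 / 2 :: real) powr (?n - \<gamma>) < 1"
    using assms powr_less_one[of 2 "- (?n - \<gamma>)"]
    by (simp add: powr_divide powr_minus_divide del: minus_diff_eq)
  have cover: "\<exists>i::nat. \<rho> * (1 / 2) ^ i / 2 \<le> dist x y \<and> dist x y < \<rho> * (1 / 2) ^ i"
    if pos: "0 < \<rho>" "y \<in> ball x \<rho>" "y \<noteq> x" for x y :: 'a and \<rho> :: real
  proof -
    let ?P = "\<lambda>i. \<rho> * (1 / 2) ^ i / 2 \<le> dist x y"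
    obtain k where "(1 / 2 :: real) ^ k < dist x y / \<rho>"
      using pos real_arch_pow_inv[of "dist x y / \<rho>" "1 / 2"] by auto
    then have "\<rho> * (1 / 2) ^ k < dist x y"
      using that by (simp only: pos_less_divide_eq mult.commute)
    moreover have "0 < \<rho> * (1 / 2) ^ k" using that by simp
    ultimately have P: "?P k" by linarith
    define i where "i = (LEAST i. ?P i)"
    have "?P i" unfolding i_def by (rule LeastI[of ?P, OF P])
    moreover have "dist x y < \<rho> * (1 / 2) ^ i"
    proof (cases i)
      case 0
      then show ?thesis using that by simp
    next
      case (Suc j)
      then have "\<not> ?P j" unfolding i_def by (intro not_less_Least) auto
      then show ?thesis using Suc by simp
    qed
    ultimately show ?thesis by blast
  qed
  show ?thesis
    by (rule that[OF _ nn_integral_dist_powr_geometric[OF assms(1) _ m _ cover]])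
      (use assms m in auto)
qed

lemma nn_integral_dist_powr_outside_ball:
  assumes "real DIM('a::euclidean_space) < \<gamma>"
  obtains C where "0 \<le> C"
    "\<And>(x::'a) \<rho>. 0 < \<rho> \<Longrightarrow> (\<integral>\<^sup>+y\<in>- ball x \<rho>. ennreal (dist x y powr - \<gamma>) \<partial>lborel)
      \<le> ennreal (C * \<rho> powr (real DIM('a) - \<gamma>))"
proof -
  let ?n = "real DIM('a)"
  let ?C = "2 powr \<gamma> * unit_ball_vol ?n / (1 - 2 powr (?n - \<gamma>))"
  have m: "(2 :: real) powr (?n - \<gamma>) < 1" and \<gamma>: "0 < \<gamma>"
    using assms by (auto simp: powr_less_one)
  have cover: "\<exists>i::nat. 2 * \<rho> * 2 ^ i / 2 \<le> dist x y \<and> dist x y < 2 * \<rho> * 2 ^ i"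
    if "0 < \<rho>" "y \<in> - ball x \<rho>" for x y :: 'a and \<rho> :: real
  proof -
    let ?P = "\<lambda>i. dist x y < 2 * \<rho> * 2 ^ i"
    obtain k where "dist x y / (2 * \<rho>) < 2 ^ k"
      using real_arch_pow[of 2 "dist x y / (2 * \<rho>)"] by auto
    then have P: "?P k" using that by (simp add: field_simps)
    define i where "i = (LEAST i. ?P i)"
    have "?P i" unfolding i_def by (rule LeastI[of ?P, OF P])
    moreover have "2 * \<rho> * 2 ^ i / 2 \<le> dist x y"
    proof (cases i)
      case 0
      then show ?thesis using that by simp
    next
      case (Suc j)
      then have "\<not> ?P j" unfolding i_def by (intro not_less_Least) auto
      then show ?thesis using Suc by simp
    qed
    ultimately show ?thesis by blast
  qed
  have bound: "(\<integral>\<^sup>+y\<in>- ball x \<rho>. ennreal (dist x y powr - \<gamma>) \<partial>lborel)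
      \<le> ennreal (?C * 2 powr (?n - \<gamma>) * \<rho> powr (?n - \<gamma>))"
    if "0 < \<rho>" for x :: 'a and \<rho>
  proof -
    have "(\<integral>\<^sup>+y\<in>- ball x \<rho>. ennreal (dist x y powr - \<gamma>) \<partial>lborel)
        \<le> ennreal (?C * (2 * \<rho>) powr (?n - \<gamma>))"
      using that by (intro nn_integral_dist_powr_geometric[OF \<gamma> _ m] cover) auto
    then show ?thesis using that by (simp add: powr_mult mult.assoc)
  qed
  show ?thesis
    by (rule that[OF _ bound]) (use m in auto)
qed

section \<open>A bilinear estimate for the Riesz kernel\<close>

lemma riesz_kernel_eq_dist:
  fixes x y :: "real ^ 'n"
  shows "x \<noteq> y \<Longrightarrow> riesz_kernel \<beta> x y = ennreal (dist x y powr - (real CARD('n) - \<beta>))"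
  by (simp add: riesz_kernel_def dist_norm)

lemma riesz_kernel_commute: "riesz_kernel \<beta> x y = riesz_kernel \<beta> y x"
  by (auto simp: riesz_kernel_def norm_minus_commute)

lemma riesz_kernel_measurable_pair [measurable]:
  "(\<lambda>(x, y). riesz_kernel \<beta> x y) \<in> borel_measurable (borel \<Otimes>\<^sub>M borel)"
  unfolding riesz_kernel_def by measurable

lemma riesz_kernel_measurable [measurable]: "riesz_kernel \<beta> x \<in> borel_measurable borel"
  unfolding riesz_kernel_def by measurable

text \<open>
  The potential of a bounded function with finite \<open>\<integral> h\<^sup>t\<close> is bounded, with the dependence on the bound \<open>b\<close>
  that scaling dictates. Inside the ball of radius \<open>\<rho> = b\<^bsup>-t/n\<^esup>\<close> use \<open>h \<le> b\<close>; outside, where the kernel is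
  integrable to the power conjugate to \<open>t\<close> because \<open>\<beta>t < n\<close>, use Young's inequality. This choice of \<open>\<rho>\<close>
  balances the two parts.
\<close>

lemma riesz_potential_le_of_bounded:
  fixes \<beta> t :: real
  assumes "0 < \<beta>" "1 < t" "\<beta> * t < real CARD('n)"
  obtains C where "0 < C"
    "\<And>(h :: real ^ 'n \<Rightarrow> ennreal) x b. h \<in> borel_measurable borel \<Longrightarrow> 0 < b \<Longrightarrow> (\<And>y. h y \<le> ennreal b) \<Longrightarrow>
      (\<integral>\<^sup>+y. riesz_kernel \<beta> x y * h y \<partial>lborel)
        \<le> ennreal C * (1 + (\<integral>\<^sup>+y. h y epowr t \<partial>lborel))
          * ennreal (b powr (1 - \<beta> * t / real CARD('n)))"
proof -
  let ?n = "real CARD('n)"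
  define \<tau> where "\<tau> = t / (t - 1)"
  define \<gamma> where "\<gamma> = (?n - \<beta>) * \<tau>"
  define e where "e = 1 - \<beta> * t / ?n"
  have \<tau>: "0 < \<tau>" "1 / \<tau> + 1 / t = 1"
    using assms by (auto simp: \<tau>_def field_simps)
  have \<beta>: "\<beta> < ?n"
    using assms mult_strict_left_mono[of 1 t \<beta>] by linarith
  have \<gamma>: "?n < \<gamma>"
    using assms by (simp add: \<gamma>_def \<tau>_def field_simps)
  obtain C\<^sub>1 where C\<^sub>1: "0 \<le> C\<^sub>1" "\<And>(x :: real ^ 'n) \<rho>. 0 < \<rho> \<Longrightarrow>
      (\<integral>\<^sup>+y\<in>ball x \<rho>. ennreal (dist x y powr - (?n - \<beta>)) \<partial>lborel) \<le> ennreal (C\<^sub>1 * \<rho> powr \<beta>)"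
    using nn_integral_dist_powr_ball[of "?n - \<beta>", where ?'a = "real ^ 'n"] assms(1) \<beta> by auto
  obtain C\<^sub>2 where C\<^sub>2: "0 \<le> C\<^sub>2" "\<And>(x :: real ^ 'n) \<rho>. 0 < \<rho> \<Longrightarrow>
      (\<integral>\<^sup>+y\<in>- ball x \<rho>. ennreal (dist x y powr - \<gamma>) \<partial>lborel) \<le> ennreal (C\<^sub>2 * \<rho> powr (?n - \<gamma>))"
    using nn_integral_dist_powr_outside_ball[of \<gamma>, where ?'a = "real ^ 'n"] \<gamma> by auto
  have main: "(\<integral>\<^sup>+y. riesz_kernel \<beta> x y * h y \<partial>lborel)
        \<le> ennreal (C\<^sub>1 + C\<^sub>2 + 1) * (1 + (\<integral>\<^sup>+y. h y epowr t \<partial>lborel)) * ennreal (b powr e)"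
    if h [measurable]: "h \<in> borel_measurable borel" and b: "0 < b" and hb: "\<And>y. h y \<le> ennreal b"
    for h :: "real ^ 'n \<Rightarrow> ennreal" and x b
  proof -
    define \<rho> where "\<rho> = b powr - (t / ?n)"
    \<comment> \<open>The weight in Young's inequality \<open>k h = (1/c) (c k) h\<close>: it makes \<open>c\<^sup>\<tau> \<integral> k\<^sup>\<tau>\<close> over the outer region independent of \<open>\<rho>\<close>.\<close>
    define c where "c = \<rho> powr ((\<gamma> - ?n) / \<tau>)"
    have \<rho>: "0 < \<rho>" and c: "0 < c" using b by (auto simp: \<rho>_def c_def)
    have b_near: "b * \<rho> powr \<beta> = b powr e"
    proof -
      have "b * \<rho> powr \<beta> = b powr 1 * b powr (- (t / ?n) * \<beta>)"
        using b by (simp add: \<rho>_def powr_powr)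
      also have "\<dots> = b powr e"
        unfolding powr_add[symmetric] e_def by (simp add: mult.commute)
      finally show ?thesis .
    qed
    have c_far: "1 / c = b powr e"
    proof -
      have "(\<gamma> - ?n) / \<tau> = ?n / t - \<beta>"
        using assms \<tau>(1) by (simp add: \<gamma>_def \<tau>_def field_simps)
      then have "1 / c = b powr (t / ?n * (?n / t - \<beta>))"
        by (simp add: c_def \<rho>_def powr_powr flip: powr_minus_divide)
      also have "t / ?n * (?n / t - \<beta>) = e"
        using assms by (simp add: e_def field_simps)
      finally show ?thesis .
    qed
    have c\<tau>: "c powr \<tau> * \<rho> powr (?n - \<gamma>) = 1"
      using \<tau>(1) \<rho> by (simp add: c_def powr_powr flip: powr_add)
    define near where "near y = ennreal (dist x y powr - (?n - \<beta>)) * indicator (ball x \<rho>) y" for y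
    define far where "far y = ennreal (dist x y powr - \<gamma>) * indicator (- ball x \<rho>) y" for y
    have [measurable]: "near \<in> borel_measurable borel" "far \<in> borel_measurable borel"
      unfolding near_def far_def
      by (intro borel_measurable_times_ennreal borel_measurable_indicator; simp; measurable)+
    have pt: "riesz_kernel \<beta> x y * h y
        \<le> ennreal b * near y + ennreal (1 / c) * (ennreal (c powr \<tau>) * far y + h y epowr t)"
      if "y \<noteq> x" for y
    proof (cases "y \<in> ball x \<rho>")
      case True
      then have "riesz_kernel \<beta> x y * h y \<le> ennreal b * near y"
        using that hb by (simp add: near_def riesz_kernel_eq_dist mult.commute mult_right_mono)
      then show ?thesis by (simp add: add_increasing2)
    next
      case False
      let ?k = "riesz_kernel \<beta> x y"
      have "riesz_kernel \<beta> x y epowr \<tau> = ennreal (dist x y powr - \<gamma>)"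
        using that by (simp add: riesz_kernel_eq_dist epowr_ennreal powr_powr \<gamma>_def
            flip: mult_minus_left)
      then have k: "(ennreal c * ?k) epowr \<tau> = ennreal (c powr \<tau>) * far y"
        using False c \<tau>(1) by (simp add: far_def epowr_mult epowr_ennreal)
      have "?k * h y = ennreal (1 / c) * (ennreal c * ?k * h y)"
        using c by (simp add: mult.assoc[symmetric] flip: ennreal_mult)
      also have "ennreal c * ?k * h y \<le> (ennreal c * ?k) epowr \<tau> + h y epowr t"
        using epowr_prod_le_sum[of \<tau> t 1 1 1 "ennreal c * ?k" "h y"] \<tau> assms by simp
      finally have "?k * h y \<le> ennreal (1 / c) * (ennreal (c powr \<tau>) * far y + h y epowr t)"
        unfolding k by (simp add: mult_left_mono)
      then show ?thesis by (simp add: add_increasing)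
    qed
    have "(\<integral>\<^sup>+y. riesz_kernel \<beta> x y * h y \<partial>lborel)
        \<le> (\<integral>\<^sup>+y. ennreal b * near y
            + ennreal (1 / c) * (ennreal (c powr \<tau>) * far y + h y epowr t) \<partial>lborel)"
      using AE_lborel_singleton[of x] pt by (intro nn_integral_mono_AE) auto
    also have "\<dots> = ennreal b * (\<integral>\<^sup>+y. near y \<partial>lborel) + ennreal (1 / c) *
        (ennreal (c powr \<tau>) * (\<integral>\<^sup>+y. far y \<partial>lborel) + (\<integral>\<^sup>+y. h y epowr t \<partial>lborel))"
      by (simp add: nn_integral_add nn_integral_cmult)
    also have "\<dots> \<le> ennreal b * ennreal (C\<^sub>1 * \<rho> powr \<beta>) + ennreal (1 / c) *
        (ennreal (c powr \<tau>) * ennreal (C\<^sub>2 * \<rho> powr (?n - \<gamma>)) + (\<integral>\<^sup>+y. h y epowr t \<partial>lborel))"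
      unfolding near_def far_def using \<rho> by (intro add_mono mult_left_mono C\<^sub>1 C\<^sub>2) auto
    also have "ennreal b * ennreal (C\<^sub>1 * \<rho> powr \<beta>) = ennreal C\<^sub>1 * ennreal (b powr e)"
      using b C\<^sub>1(1) by (simp add: b_near[symmetric] mult_ac flip: ennreal_mult)
    also have "ennreal (c powr \<tau>) * ennreal (C\<^sub>2 * \<rho> powr (?n - \<gamma>)) = ennreal C\<^sub>2"
      using C\<^sub>2(1) c\<tau> by (simp add: mult.left_commute flip: ennreal_mult)
    also have "ennreal C\<^sub>1 * ennreal (b powr e)
          + ennreal (1 / c) * (ennreal C\<^sub>2 + (\<integral>\<^sup>+y. h y epowr t \<partial>lborel))
        = (ennreal (C\<^sub>1 + C\<^sub>2) + (\<integral>\<^sup>+y. h y epowr t \<partial>lborel)) * ennreal (b powr e)"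
      unfolding c_far using C\<^sub>1(1) C\<^sub>2(1) by (simp add: distrib_left distrib_right mult_ac add_ac)
    also have "\<dots> \<le> (ennreal (C\<^sub>1 + C\<^sub>2 + 1) * 1
        + ennreal (C\<^sub>1 + C\<^sub>2 + 1) * (\<integral>\<^sup>+y. h y epowr t \<partial>lborel)) * ennreal (b powr e)"
    proof (intro mult_right_mono add_mono)
      have "1 * (\<integral>\<^sup>+y. h y epowr t \<partial>lborel)
          \<le> ennreal (C\<^sub>1 + C\<^sub>2 + 1) * (\<integral>\<^sup>+y. h y epowr t \<partial>lborel)"
        using C\<^sub>1(1) C\<^sub>2(1) by (intro mult_right_mono) auto
      then show "(\<integral>\<^sup>+y. h y epowr t \<partial>lborel)
          \<le> ennreal (C\<^sub>1 + C\<^sub>2 + 1) * (\<integral>\<^sup>+y. h y epowr t \<partial>lborel)"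
        by simp
    qed (auto intro!: ennreal_leI)
    finally show ?thesis by (simp only: distrib_left)
  qed
  show ?thesis
    by (rule that[of "C\<^sub>1 + C\<^sub>2 + 1"]) (use C\<^sub>1(1) C\<^sub>2(1) main in \<open>auto simp: e_def\<close>)
qed

text \<open>
  The step that produces \<open>\<integral> f\<^sup>p\<close> when \<open>a = f x\<close> is integrated over \<open>x\<close>. Truncating \<open>h\<close> at
  \<open>b = a\<^bsup>p/t\<^esup>\<close> is the right threshold because \<open>a \<cdot> b\<^bsup>1-\<beta>t/n\<^esup> = a\<^sup>p\<close> under the relation between \<open>p\<close> and
  \<open>t\<close>. The cases \<open>a = 0\<close> and \<open>a = \<infinity>\<close> are trivial since the constant is positive.
\<close>

lemma riesz_potential_truncated_le:
  fixes \<beta> p t :: real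
  assumes "0 < \<beta>" "1 < p" "1 < t" and pt: "1 / p + 1 / t = 1 + \<beta> / real CARD('n)"
  obtains C where "0 < C"
    "\<And>(h :: real ^ 'n \<Rightarrow> ennreal) x a. h \<in> borel_measurable borel \<Longrightarrow>
      a * (\<integral>\<^sup>+y. riesz_kernel \<beta> x y * (if h y \<le> a epowr (p / t) then h y else 0) \<partial>lborel)
        \<le> ennreal C * (1 + (\<integral>\<^sup>+y. h y epowr t \<partial>lborel)) * a epowr p"
proof -
  let ?n = "real CARD('n)"
  have "\<beta> / ?n < 1 / t"
    using assms by (smt (verit) divide_less_eq_1)
  then have \<beta>t: "\<beta> * t < ?n"
    using assms by (simp add: field_simps)
  obtain C where C: "0 < C"
    "\<And>(h :: real ^ 'n \<Rightarrow> ennreal) x b. h \<in> borel_measurable borel \<Longrightarrow> 0 < b \<Longrightarrow> (\<And>y. h y \<le> ennreal b) \<Longrightarrow>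
      (\<integral>\<^sup>+y. riesz_kernel \<beta> x y * h y \<partial>lborel)
        \<le> ennreal C * (1 + (\<integral>\<^sup>+y. h y epowr t \<partial>lborel)) * ennreal (b powr (1 - \<beta> * t / ?n))"
    using riesz_potential_le_of_bounded[OF assms(1,3) \<beta>t] by blast
  have main: "a * (\<integral>\<^sup>+y. riesz_kernel \<beta> x y * (if h y \<le> a epowr (p / t) then h y else 0) \<partial>lborel)
        \<le> ennreal C * (1 + (\<integral>\<^sup>+y. h y epowr t \<partial>lborel)) * a epowr p"
    if [measurable]: "h \<in> borel_measurable borel" for h :: "real ^ 'n \<Rightarrow> ennreal" and x a
  proof (cases "a = 0 \<or> a = top")
    case True
    then show ?thesis
    proof
      assume "a = top"
      moreover have "ennreal C * (1 + (\<integral>\<^sup>+y. h y epowr t \<partial>lborel)) \<noteq> 0"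
        using C(1) by simp
      ultimately show ?thesis by (simp add: ennreal_mult_top)
    qed simp
  next
    case False
    then obtain r where r: "a = ennreal r" "0 < r"
      by (cases a) (auto simp: less_le)
    let ?h = "\<lambda>y. if h y \<le> a epowr (p / t) then h y else 0"
    have exponent: "1 + p / t * (1 - \<beta> * t / ?n) = p"
    proof -
      have "1 + p / t * (1 - \<beta> * t / ?n) = 1 + p * (1 / t - \<beta> / ?n)"
        using assms by (simp add: field_simps)
      also have "1 / t - \<beta> / ?n = 1 - 1 / p" using pt by simp
      finally show ?thesis using assms by (simp add: field_simps)
    qed
    have "(\<integral>\<^sup>+y. riesz_kernel \<beta> x y * ?h y \<partial>lborel)
        \<le> ennreal C * (1 + (\<integral>\<^sup>+y. ?h y epowr t \<partial>lborel))
          * ennreal ((r powr (p / t)) powr (1 - \<beta> * t / ?n))"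
      using r by (intro C(2)) (auto simp: epowr_ennreal)
    also have "\<dots> \<le> ennreal C * (1 + (\<integral>\<^sup>+y. h y epowr t \<partial>lborel))
          * ennreal ((r powr (p / t)) powr (1 - \<beta> * t / ?n))"
      by (intro mult_right_mono mult_left_mono add_mono nn_integral_mono) auto
    finally have "a * (\<integral>\<^sup>+y. riesz_kernel \<beta> x y * ?h y \<partial>lborel)
        \<le> ennreal r * (ennreal C * (1 + (\<integral>\<^sup>+y. h y epowr t \<partial>lborel))
          * ennreal ((r powr (p / t)) powr (1 - \<beta> * t / ?n)))"
      unfolding r(1) by (rule mult_left_mono) simp
    also have "\<dots> = ennreal C * (1 + (\<integral>\<^sup>+y. h y epowr t \<partial>lborel))
          * (ennreal r * ennreal (r powr (p / t * (1 - \<beta> * t / ?n))))"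
      by (simp only: mult_ac powr_powr)
    also have "ennreal r * ennreal (r powr (p / t * (1 - \<beta> * t / ?n))) = a epowr p"
    proof -
      have "ennreal r * ennreal (r powr (p / t * (1 - \<beta> * t / ?n)))
          = ennreal (r powr (1 + p / t * (1 - \<beta> * t / ?n)))"
        unfolding powr_add using r(2) by (simp flip: ennreal_mult)
      then show ?thesis unfolding exponent using r by (simp add: epowr_ennreal)
    qed
    finally show ?thesis .
  qed
  show ?thesis by (rule that[OF C(1) main])
qed

text \<open>
  The Hardy-Littlewood-Sobolev inequality, in a form that is not homogeneous but suffices after
  normalization: of the two conditions \<open>h y \<le> (f x)\<^bsup>p/t\<^esup>\<close> and \<open>f x \<le> (h y)\<^bsup>t/p\<^esup>\<close> at least one holds, and on
  each of these regions one of the two functions is truncated by a power of the other.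
\<close>

lemma riesz_kernel_bilinear_le:
  fixes \<beta> p t :: real
  assumes "0 < \<beta>" "1 < p" "1 < t" and pt: "1 / p + 1 / t = 1 + \<beta> / real CARD('n)"
  obtains C where "0 < C"
    "\<And>f h :: real ^ 'n \<Rightarrow> ennreal. f \<in> borel_measurable borel \<Longrightarrow> h \<in> borel_measurable borel \<Longrightarrow>
      (\<integral>\<^sup>+x. f x * (\<integral>\<^sup>+y. riesz_kernel \<beta> x y * h y \<partial>lborel) \<partial>lborel)
        \<le> ennreal C * ((1 + (\<integral>\<^sup>+y. h y epowr t \<partial>lborel)) * (\<integral>\<^sup>+x. f x epowr p \<partial>lborel)
          + (1 + (\<integral>\<^sup>+x. f x epowr p \<partial>lborel)) * (\<integral>\<^sup>+y. h y epowr t \<partial>lborel))"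
proof -
  have tp: "1 / t + 1 / p = 1 + \<beta> / real CARD('n)" using pt by simp
  obtain C\<^sub>1 where C\<^sub>1: "0 < C\<^sub>1"
    "\<And>(h :: real ^ 'n \<Rightarrow> ennreal) x a. h \<in> borel_measurable borel \<Longrightarrow>
      a * (\<integral>\<^sup>+y. riesz_kernel \<beta> x y * (if h y \<le> a epowr (p / t) then h y else 0) \<partial>lborel)
        \<le> ennreal C\<^sub>1 * (1 + (\<integral>\<^sup>+y. h y epowr t \<partial>lborel)) * a epowr p"
    using riesz_potential_truncated_le[OF assms(1-3) pt] by blast
  obtain C\<^sub>2 where C\<^sub>2: "0 < C\<^sub>2"
    "\<And>(f :: real ^ 'n \<Rightarrow> ennreal) y a. f \<in> borel_measurable borel \<Longrightarrow>
      a * (\<integral>\<^sup>+x. riesz_kernel \<beta> y x * (if f x \<le> a epowr (t / p) then f x else 0) \<partial>lborel)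
        \<le> ennreal C\<^sub>2 * (1 + (\<integral>\<^sup>+x. f x epowr p \<partial>lborel)) * a epowr t"
    using riesz_potential_truncated_le[OF assms(1,3,2) tp] by blast
  have main: "(\<integral>\<^sup>+x. f x * (\<integral>\<^sup>+y. riesz_kernel \<beta> x y * h y \<partial>lborel) \<partial>lborel)
        \<le> ennreal (max C\<^sub>1 C\<^sub>2) * ((1 + (\<integral>\<^sup>+y. h y epowr t \<partial>lborel)) * (\<integral>\<^sup>+x. f x epowr p \<partial>lborel)
          + (1 + (\<integral>\<^sup>+x. f x epowr p \<partial>lborel)) * (\<integral>\<^sup>+y. h y epowr t \<partial>lborel))"
    if [measurable]: "f \<in> borel_measurable borel" "h \<in> borel_measurable borel"
    for f h :: "real ^ 'n \<Rightarrow> ennreal"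
  proof -
    let ?H = "\<integral>\<^sup>+y. h y epowr t \<partial>lborel" and ?F = "\<integral>\<^sup>+x. f x epowr p \<partial>lborel"
    let ?h = "\<lambda>x y. if h y \<le> f x epowr (p / t) then h y else 0"
    let ?f = "\<lambda>y x. if f x \<le> h y epowr (t / p) then f x else 0"
    have split: "f x * (riesz_kernel \<beta> x y * h y)
        \<le> f x * (riesz_kernel \<beta> x y * ?h x y) + h y * (riesz_kernel \<beta> y x * ?f y x)" for x y
    proof (cases "h y \<le> f x epowr (p / t)")
      case True
      then show ?thesis by (simp add: add_increasing2)
    next
      case False
      then have "(f x epowr (p / t)) epowr (t / p) \<le> h y epowr (t / p)"
        using assms by (intro epowr_mono) auto
      then have "f x \<le> h y epowr (t / p)"
        using assms by (simp add: epowr_epowr)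
      then show ?thesis
        by (simp add: riesz_kernel_commute[of \<beta> x y] mult_ac add_increasing)
    qed
    have "(\<integral>\<^sup>+x. f x * (\<integral>\<^sup>+y. riesz_kernel \<beta> x y * h y \<partial>lborel) \<partial>lborel)
        = (\<integral>\<^sup>+x. (\<integral>\<^sup>+y. f x * (riesz_kernel \<beta> x y * h y) \<partial>lborel) \<partial>lborel)"
      by (simp add: nn_integral_cmult)
    also have "\<dots> \<le> (\<integral>\<^sup>+x. (\<integral>\<^sup>+y. f x * (riesz_kernel \<beta> x y * ?h x y)
          + h y * (riesz_kernel \<beta> y x * ?f y x) \<partial>lborel) \<partial>lborel)"
      by (intro nn_integral_mono split)
    also have "\<dots> = (\<integral>\<^sup>+x. (\<integral>\<^sup>+y. f x * (riesz_kernel \<beta> x y * ?h x y) \<partial>lborel) \<partial>lborel)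
        + (\<integral>\<^sup>+x. (\<integral>\<^sup>+y. h y * (riesz_kernel \<beta> y x * ?f y x) \<partial>lborel) \<partial>lborel)"
      by (simp add: nn_integral_add)
    also have "(\<integral>\<^sup>+x. (\<integral>\<^sup>+y. h y * (riesz_kernel \<beta> y x * ?f y x) \<partial>lborel) \<partial>lborel)
        = (\<integral>\<^sup>+y. (\<integral>\<^sup>+x. h y * (riesz_kernel \<beta> y x * ?f y x) \<partial>lborel) \<partial>lborel)"
      by (rule lborel_pair.Fubini') measurable
    also have "(\<integral>\<^sup>+x. (\<integral>\<^sup>+y. f x * (riesz_kernel \<beta> x y * ?h x y) \<partial>lborel) \<partial>lborel)
        \<le> (\<integral>\<^sup>+x. ennreal C\<^sub>1 * (1 + ?H) * f x epowr p \<partial>lborel)"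
      by (intro nn_integral_mono, subst nn_integral_cmult) (auto intro!: C\<^sub>1(2))
    also have "(\<integral>\<^sup>+y. (\<integral>\<^sup>+x. h y * (riesz_kernel \<beta> y x * ?f y x) \<partial>lborel) \<partial>lborel)
        \<le> (\<integral>\<^sup>+y. ennreal C\<^sub>2 * (1 + ?F) * h y epowr t \<partial>lborel)"
      by (intro nn_integral_mono, subst nn_integral_cmult) (auto intro!: C\<^sub>2(2))
    also have "(\<integral>\<^sup>+x. ennreal C\<^sub>1 * (1 + ?H) * f x epowr p \<partial>lborel)
          + (\<integral>\<^sup>+y. ennreal C\<^sub>2 * (1 + ?F) * h y epowr t \<partial>lborel)
        = ennreal C\<^sub>1 * ((1 + ?H) * ?F) + ennreal C\<^sub>2 * ((1 + ?F) * ?H)"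
      by (simp add: nn_integral_cmult mult.assoc)
    also have "\<dots> \<le> ennreal (max C\<^sub>1 C\<^sub>2) * ((1 + ?H) * ?F) + ennreal (max C\<^sub>1 C\<^sub>2) * ((1 + ?F) * ?H)"
      by (intro add_mono mult_right_mono ennreal_leI) auto
    finally show ?thesis by (simp only: distrib_left add_mono)
  qed
  show ?thesis
    by (rule that[OF _ main]) (use C\<^sub>1(1) in auto)
qed

section \<open>The nonlinear potential operator\<close>

definition sublinear_potential ::
    "real \<Rightarrow> real \<Rightarrow> (real ^ 'n \<Rightarrow> ennreal) \<Rightarrow> (real ^ 'n \<Rightarrow> ennreal) \<Rightarrow> real ^ 'n \<Rightarrow> ennreal"
  where "sublinear_potential \<beta> q s u x =
    (\<integral>\<^sup>+y. riesz_kernel \<beta> x y * (s y * u y epowr q) \<partial>lborel)"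

lemma sublinear_potential_measurable [measurable]:
  assumes [measurable]: "s \<in> borel_measurable borel" "u \<in> borel_measurable borel"
  shows "sublinear_potential \<beta> q s u \<in> borel_measurable borel"
  unfolding sublinear_potential_def by measurable

lemma sublinear_potential_mono:
  assumes "0 < q" and "\<And>y. u y \<le> v y"
  shows "sublinear_potential \<beta> q s u x \<le> sublinear_potential \<beta> q s v x"
  unfolding sublinear_potential_def
  using assms by (intro nn_integral_mono mult_left_mono epowr_mono) auto

lemma sublinear_potential_cmult:
  assumes [measurable]: "s \<in> borel_measurable borel" "u \<in> borel_measurable borel" and "0 < q"
  shows "sublinear_potential \<beta> q s (\<lambda>y. c * u y) x = c epowr q * sublinear_potential \<beta> q s u x"
proof -
  have "sublinear_potential \<beta> q s (\<lambda>y. c * u y) x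
      = (\<integral>\<^sup>+y. c epowr q * (riesz_kernel \<beta> x y * (s y * u y epowr q)) \<partial>lborel)"
    unfolding sublinear_potential_def using assms by (simp only: epowr_mult mult_ac)
  then show ?thesis unfolding sublinear_potential_def by (simp add: nn_integral_cmult)
qed

lemma sublinear_potential_SUP:
  fixes u :: "nat \<Rightarrow> real ^ 'n \<Rightarrow> ennreal"
  assumes [measurable]: "s \<in> borel_measurable borel" "\<And>k. u k \<in> borel_measurable borel"
    and q: "0 < q" and u: "incseq u"
  shows "sublinear_potential \<beta> q s (\<lambda>y. SUP k. u k y) x = (SUP k. sublinear_potential \<beta> q s (u k) x)"
proof -
  have "sublinear_potential \<beta> q s (\<lambda>y. SUP k. u k y) x
      = (\<integral>\<^sup>+y. (SUP k. riesz_kernel \<beta> x y * (s y * u k y epowr q)) \<partial>lborel)"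
    unfolding sublinear_potential_def using q by (simp add: epowr_SUP SUP_mult_left_ennreal)
  also have "\<dots> = (SUP k. sublinear_potential \<beta> q s (u k) x)"
    unfolding sublinear_potential_def
  proof (rule nn_integral_monotone_convergence_SUP)
    show "incseq (\<lambda>k y. riesz_kernel \<beta> x y * (s y * u k y epowr q))"
      using u q by (intro monoI le_funI mult_left_mono epowr_mono) (auto simp: mono_def le_fun_def)
  qed simp
  finally show ?thesis .
qed

text \<open>
  Every point of the ball is within distance \<open>norm x + R\<close> of \<open>x\<close>. This one inequality yields the initial
  subsolution, the positivity of the solution, and the local integrability of \<open>s U\<^sup>q\<close>.
\<close>

lemma riesz_kernel_integral_lower_bound:
  fixes g :: "real ^ 'n \<Rightarrow> ennreal"
  assumes [measurable]: "g \<in> borel_measurable borel" and "\<beta> < real CARD('n)" "0 < R"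
  shows "ennreal ((norm x + R) powr (\<beta> - real CARD('n))) * (\<integral>\<^sup>+y\<in>ball 0 R. g y \<partial>lborel)
    \<le> (\<integral>\<^sup>+y. riesz_kernel \<beta> x y * g y \<partial>lborel)"
proof -
  have [measurable]: "ball (0 :: real ^ 'n) R \<in> sets borel" by simp
  have "ennreal ((norm x + R) powr (\<beta> - real CARD('n))) \<le> riesz_kernel \<beta> x y"
    if "y \<in> ball 0 R" for y
  proof (cases "x = y")
    case False
    have "dist x y \<le> norm x + R"
      using that norm_triangle_ineq4[of x y] by (simp add: dist_norm)
    then have "(norm x + R) powr (\<beta> - real CARD('n)) \<le> dist x y powr (\<beta> - real CARD('n))"
      using assms False by (intro powr_mono2') auto
    then show ?thesis using False by (simp add: riesz_kernel_eq_dist ennreal_leI)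
  qed (simp add: riesz_kernel_def)
  then have "(\<integral>\<^sup>+y. ennreal ((norm x + R) powr (\<beta> - real CARD('n))) * (g y * indicator (ball 0 R) y) \<partial>lborel)
      \<le> (\<integral>\<^sup>+y. riesz_kernel \<beta> x y * g y \<partial>lborel)"
    by (intro nn_integral_mono) (auto split: split_indicator intro!: mult_right_mono)
  then show ?thesis by (simp add: nn_integral_cmult)
qed

section \<open>The a priori bound\<close>

text \<open>
  For \<open>w\<close> with \<open>\<integral> w\<^sup>r = 1\<close> the bilinear estimate, applied to \<open>w\<^bsup>r-1\<^esup>\<close> and \<open>s w\<^sup>q\<close>, bounds
  \<open>\<integral> w\<^bsup>r-1\<^esup> T w\<close> by a constant \<open>M\<close>. If \<open>u \<le> T u\<close> and \<open>\<xi> = \<integral> u\<^sup>r\<close>, then \<open>w = c u\<close> with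
  \<open>c = \<xi>\<^bsup>-1/r\<^esup>\<close> satisfies \<open>w \<le> c\<^bsup>1-q\<^esup> T w\<close>, so that \<open>1 \<le> c\<^bsup>1-q\<^esup> M\<close>. As \<open>q < 1\<close>, this is an upper bound
  for \<open>\<xi>\<close>. The argument needs \<open>\<xi>\<close> to be finite beforehand.
\<close>

lemma subsolution_Lp_bound:
  fixes \<beta> q r S :: real and s :: "real ^ 'n \<Rightarrow> ennreal"
  assumes q: "0 < q" "q < 1" and \<beta>: "0 < \<beta>" "\<beta> < real CARD('n)"
    and r: "real CARD('n) / (real CARD('n) - \<beta>) < r"
    and S: "S = real CARD('n) * r / (real CARD('n) * (1 - q) + \<beta> * r)"
    and [measurable]: "s \<in> borel_measurable borel"
    and s_int: "(\<integral>\<^sup>+x. s x epowr S \<partial>lborel) < \<infinity>"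
  obtains K :: real where
    "\<And>u. u \<in> borel_measurable borel \<Longrightarrow> (\<And>x. u x \<le> sublinear_potential \<beta> q s u x) \<Longrightarrow>
      (\<integral>\<^sup>+x. u x epowr r \<partial>lborel) < \<infinity> \<Longrightarrow> (\<integral>\<^sup>+x. u x epowr r \<partial>lborel) \<le> ennreal K"
proof -
  let ?n = "real CARD('n)"
  have n: "0 < ?n" by simp
  have nr: "?n < r * (?n - \<beta>)"
    using r \<beta> by (simp add: field_simps)
  have "1 < ?n / (?n - \<beta>)" using \<beta> by simp
  then have r1: "1 < r" using r by linarith
  define p where "p = 1 / (1 / r + \<beta> / ?n)"
  define t where "t = r / (r - 1)"
  have inv_p: "1 / p = 1 / r + \<beta> / ?n" by (simp add: p_def)
  have pos: "0 < 1 / r + \<beta> / ?n" using r1 \<beta> n by (intro add_pos_pos) auto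
  have "1 / r + \<beta> / ?n < 1" using nr r1 n by (simp add: field_simps)
  then have p: "1 < p" using pos by (simp add: p_def)
  have t: "1 < t" using r1 by (simp add: t_def)
  have tp: "1 / t + 1 / p = 1 + \<beta> / ?n"
    unfolding inv_p t_def using r1 by (simp add: field_simps)
  have den: "0 < ?n * (1 - q) + \<beta> * r"
    using q \<beta> r1 n by (intro add_pos_pos) auto
  have S_pos: "0 < S" unfolding S using den r1 n by simp
  have "1 / S + q / r = 1 / p"
    unfolding inv_p S using den r1 n by (simp add: field_simps)
  then have pS: "p * (1 / S + q / r) = 1" using p by simp
  obtain C where C: "0 < C"
    "\<And>f h :: real ^ 'n \<Rightarrow> ennreal. f \<in> borel_measurable borel \<Longrightarrow> h \<in> borel_measurable borel \<Longrightarrow>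
      (\<integral>\<^sup>+x. f x * (\<integral>\<^sup>+y. riesz_kernel \<beta> x y * h y \<partial>lborel) \<partial>lborel)
        \<le> ennreal C * ((1 + (\<integral>\<^sup>+y. h y epowr p \<partial>lborel)) * (\<integral>\<^sup>+x. f x epowr t \<partial>lborel)
          + (1 + (\<integral>\<^sup>+x. f x epowr t \<partial>lborel)) * (\<integral>\<^sup>+y. h y epowr p \<partial>lborel))"
    using riesz_kernel_bilinear_le[OF \<beta>(1) t p tp] by blast
  define A where "A = (\<integral>\<^sup>+x. s x epowr S \<partial>lborel) + 1"
  have "ennreal C * ((1 + A) * 1 + (1 + 1) * A) < top"
    using s_int by (simp add: A_def ennreal_mult_less_top)
  then obtain M where M: "0 \<le> M" "ennreal C * ((1 + A) * 1 + (1 + 1) * A) = ennreal M"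
    by (cases "ennreal C * ((1 + A) * 1 + (1 + 1) * A)") auto
  have normalized: "(\<integral>\<^sup>+x. w x epowr (r - 1) * sublinear_potential \<beta> q s w x \<partial>lborel) \<le> ennreal M"
    if [measurable]: "w \<in> borel_measurable borel" and w1: "(\<integral>\<^sup>+x. w x epowr r \<partial>lborel) = 1" for w
  proof -
    have h: "(\<integral>\<^sup>+y. (s y * w y epowr q) epowr p \<partial>lborel) \<le> A"
    proof -
      have "(s y * w y epowr q) epowr p \<le> s y epowr S + w y epowr r" for y
        using epowr_prod_le_sum[of S r 1 q p "s y" "w y"] S_pos r1 q p pS by simp
      then have "(\<integral>\<^sup>+y. (s y * w y epowr q) epowr p \<partial>lborel)
          \<le> (\<integral>\<^sup>+y. s y epowr S + w y epowr r \<partial>lborel)"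
        by (intro nn_integral_mono)
      then show ?thesis by (simp add: nn_integral_add w1 A_def)
    qed
    have f: "(\<integral>\<^sup>+x. (w x epowr (r - 1)) epowr t \<partial>lborel) = 1"
      using r1 w1 by (simp add: epowr_epowr t_def)
    have "(\<integral>\<^sup>+x. w x epowr (r - 1) * sublinear_potential \<beta> q s w x \<partial>lborel)
        \<le> ennreal C * ((1 + (\<integral>\<^sup>+y. (s y * w y epowr q) epowr p \<partial>lborel)) * 1
          + (1 + 1) * (\<integral>\<^sup>+y. (s y * w y epowr q) epowr p \<partial>lborel))"
      unfolding sublinear_potential_def by (subst (2 4) f[symmetric]) (rule C(2); measurable)
    also have "\<dots> \<le> ennreal C * ((1 + A) * 1 + (1 + 1) * A)"
      by (intro mult_left_mono mult_right_mono add_mono h order_refl) auto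
    finally show ?thesis unfolding M(2) .
  qed
  have "(\<integral>\<^sup>+x. u x epowr r \<partial>lborel) \<le> ennreal (M powr (r / (1 - q)))"
    if [measurable]: "u \<in> borel_measurable borel"
      and sub: "\<And>x. u x \<le> sublinear_potential \<beta> q s u x"
      and fin: "(\<integral>\<^sup>+x. u x epowr r \<partial>lborel) < \<infinity>" for u
  proof (cases "(\<integral>\<^sup>+x. u x epowr r \<partial>lborel) = 0")
    case False
    then obtain \<xi> where \<xi>: "(\<integral>\<^sup>+x. u x epowr r \<partial>lborel) = ennreal \<xi>" "0 < \<xi>"
      using fin by (cases "\<integral>\<^sup>+x. u x epowr r \<partial>lborel") (auto simp: less_le)
    define c where "c = \<xi> powr - (1 / r)"
    let ?w = "\<lambda>x. ennreal c * u x"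
    have c: "0 < c" using \<xi> by (simp add: c_def)
    have cr: "c powr r = 1 / \<xi>"
      unfolding c_def powr_powr using \<xi>(2) r1 by (simp add: powr_minus_divide)
    have w1: "(\<integral>\<^sup>+x. ?w x epowr r \<partial>lborel) = 1"
      using c r1 \<xi> by (simp add: epowr_mult epowr_ennreal nn_integral_cmult cr flip: ennreal_mult)
    have w_sub: "?w x \<le> ennreal (c powr (1 - q)) * sublinear_potential \<beta> q s ?w x" for x
    proof -
      have "ennreal (c powr (1 - q)) * ennreal c epowr q = ennreal c"
        using c by (simp add: epowr_ennreal flip: ennreal_mult powr_add)
      then have "ennreal (c powr (1 - q)) * sublinear_potential \<beta> q s ?w x
          = ennreal c * sublinear_potential \<beta> q s u x"
        using q by (simp add: sublinear_potential_cmult mult.assoc[symmetric])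
      then show ?thesis using sub[of x] by (simp add: mult_left_mono)
    qed
    have "?w x epowr r
        \<le> ennreal (c powr (1 - q)) * (?w x epowr (r - 1) * sublinear_potential \<beta> q s ?w x)" for x
    proof -
      have "?w x epowr r = ?w x epowr (r - 1) * ?w x"
        using epowr_add[of "?w x" "r - 1" 1] by simp
      also have "\<dots> \<le> ?w x epowr (r - 1) * (ennreal (c powr (1 - q)) * sublinear_potential \<beta> q s ?w x)"
        by (intro mult_left_mono w_sub) simp
      finally show ?thesis by (simp only: mult.left_commute)
    qed
    then have "1 \<le> (\<integral>\<^sup>+x. ennreal (c powr (1 - q))
        * (?w x epowr (r - 1) * sublinear_potential \<beta> q s ?w x) \<partial>lborel)"
      unfolding w1[symmetric] by (intro nn_integral_mono)
    also have "\<dots> = ennreal (c powr (1 - q))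
        * (\<integral>\<^sup>+x. ?w x epowr (r - 1) * sublinear_potential \<beta> q s ?w x \<partial>lborel)"
      by (rule nn_integral_cmult) measurable
    also have "\<dots> \<le> ennreal (c powr (1 - q)) * ennreal M"
      by (intro mult_left_mono normalized w1) auto
    finally have "1 \<le> c powr (1 - q) * M"
      using M(1) by (simp flip: ennreal_mult ennreal_1)
    also have "c powr (1 - q) = 1 / \<xi> powr ((1 - q) / r)"
      using \<xi>(2) by (simp add: c_def powr_powr flip: powr_minus_divide)
    finally have "\<xi> powr ((1 - q) / r) \<le> M"
      using \<xi>(2) by (simp add: field_simps)
    then have "(\<xi> powr ((1 - q) / r)) powr (r / (1 - q)) \<le> M powr (r / (1 - q))"
      using q r1 by (intro powr_mono2) auto
    then show ?thesis
      unfolding \<xi>(1) using \<xi>(2) q r1 by (intro ennreal_leI) (simp add: powr_powr)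
  qed simp
  then show ?thesis using that by blast
qed

text \<open>
  A positive lower limit would bound \<open>u\<close> below by a positive constant outside a ball, a set of infinite
  measure.
\<close>

lemma Liminf_at_infinity_eq_0:
  fixes u :: "'a::euclidean_space \<Rightarrow> ennreal"
  assumes r: "0 < r" and fin: "(\<integral>\<^sup>+x. u x epowr r \<partial>lborel) < \<infinity>"
  shows "Liminf at_infinity u = 0"
proof (rule ccontr)
  assume "Liminf at_infinity u \<noteq> 0"
  then obtain y where y: "0 < y" "y < Liminf at_infinity u"
    using dense[of 0 "Liminf at_infinity u"] by (auto simp: zero_less_iff_neq_zero)
  then have "eventually (\<lambda>x. y < u x) at_infinity"
    using le_Liminf_iff[of "Liminf at_infinity u" at_infinity u] by simp
  then obtain R where R: "\<And>x. R \<le> norm x \<Longrightarrow> y < u x"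
    unfolding eventually_at_infinity by blast
  have "emeasure lborel (UNIV - ball (0 :: 'a) \<bar>R\<bar>) = emeasure lborel (UNIV :: 'a set) - emeasure lborel (ball (0 :: 'a) \<bar>R\<bar>)"
    by (intro emeasure_Diff) (auto simp: emeasure_ball)
  then have big: "emeasure lborel (UNIV - ball (0 :: 'a) \<bar>R\<bar>) = \<infinity>"
    by (simp add: emeasure_ball ennreal_top_minus)
  have "y epowr r \<noteq> 0"
    using y(1) by (cases y) (auto simp: epowr_ennreal)
  then have "\<infinity> = (\<integral>\<^sup>+x. y epowr r * indicator (UNIV - ball (0 :: 'a) \<bar>R\<bar>) x \<partial>lborel)"
    using big by (subst nn_integral_cmult_indicator) (auto simp: ennreal_mult_top)
  also have "\<dots> \<le> (\<integral>\<^sup>+x. u x epowr r \<partial>lborel)"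
    using R r by (intro nn_integral_mono) (auto split: split_indicator intro!: epowr_mono[OF less_imp_le])
  finally show False using fin by simp
qed

section \<open>Construction of the solution\<close>

text \<open>
  On the ball, \<open>T\<close> applied to \<open>c\<close> times the indicator is at least \<open>c\<^sup>q m\<close>, where \<open>m\<close> is the mass of \<open>s\<close>
  in the ball times the lower bound \<open>(2R)\<^bsup>\<beta>-n\<^esup>\<close> of the kernel. Equality \<open>c\<^sup>q m = c\<close> holds for
  \<open>c = m\<^bsup>1/(1-q)\<^esup>\<close>. Since the mass of \<open>s\<close> may be infinite, \<open>m\<close> is capped at \<open>1\<close>.
\<close>

lemma sublinear_potential_subsolution:
  fixes s :: "real ^ 'n \<Rightarrow> ennreal"
  assumes q: "0 < q" "q < 1" and \<beta>: "\<beta> < real CARD('n)"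
    and [measurable]: "s \<in> borel_measurable borel"
    and R: "0 < R" and mass: "(\<integral>\<^sup>+y\<in>ball 0 R. s y \<partial>lborel) \<noteq> 0"
  obtains c where "0 < c" "c \<le> 1"
    "\<And>x. 0 < sublinear_potential \<beta> q s (\<lambda>y. ennreal c * indicator (ball 0 R) y) x"
    "\<And>x. ennreal c * indicator (ball 0 R) x
      \<le> sublinear_potential \<beta> q s (\<lambda>y. ennreal c * indicator (ball 0 R) y) x"
proof -
  let ?e = "\<beta> - real CARD('n)"
  have [measurable]: "ball (0 :: real ^ 'n) R \<in> sets borel" by simp
  define m where "m = min 1 (ennreal ((2 * R) powr ?e) * (\<integral>\<^sup>+y\<in>ball 0 R. s y \<partial>lborel))"
  have "m \<noteq> 0" "m \<le> 1"
    using R mass by (auto simp: m_def min_def)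
  then obtain \<mu> where \<mu>: "m = ennreal \<mu>" "0 < \<mu>" "\<mu> \<le> 1"
    by (cases m) (auto simp: less_le top_unique)
  define c where "c = \<mu> powr (1 / (1 - q))"
  have c: "0 < c" "c \<le> 1"
    using \<mu> q by (auto simp: c_def powr_le1)
  have c_eq: "c powr q * \<mu> = c"
  proof -
    have "c powr q * \<mu> = \<mu> powr (1 / (1 - q) * q + 1)"
      unfolding c_def powr_powr powr_add using \<mu>(2) by simp
    also have "1 / (1 - q) * q + 1 = 1 / (1 - q)" using q by (simp add: field_simps)
    finally show ?thesis by (simp only: c_def)
  qed
  let ?u = "\<lambda>y. ennreal c * indicator (ball 0 R) y"
  have lower: "ennreal (c powr q) * (ennreal ((norm x + R) powr ?e) * (\<integral>\<^sup>+y\<in>ball 0 R. s y \<partial>lborel))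
      \<le> sublinear_potential \<beta> q s ?u x" for x :: "real ^ 'n"
  proof -
    have "(\<integral>\<^sup>+y\<in>ball 0 R. (s y * ?u y epowr q) \<partial>lborel)
        = (\<integral>\<^sup>+y. ennreal (c powr q) * (s y * indicator (ball 0 R) y) \<partial>lborel)"
      using c by (intro nn_integral_cong) (simp split: split_indicator add: epowr_ennreal mult.commute)
    also have "\<dots> = ennreal (c powr q) * (\<integral>\<^sup>+y\<in>ball 0 R. s y \<partial>lborel)"
      by (rule nn_integral_cmult) measurable
    finally show ?thesis
      using riesz_kernel_integral_lower_bound[of "\<lambda>y. s y * ?u y epowr q" \<beta> R x] \<beta> R
      by (simp add: sublinear_potential_def mult.left_commute)
  qed
  have "0 < sublinear_potential \<beta> q s ?u x" for x
  proof -
    have "0 < norm x + R" using R by (simp add: add_nonneg_pos)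
    then have "0 < ennreal (c powr q) * (ennreal ((norm x + R) powr ?e) * (\<integral>\<^sup>+y\<in>ball 0 R. s y \<partial>lborel))"
      using mass c by (simp add: zero_less_iff_neq_zero)
    then show ?thesis using lower[of x] by (rule less_le_trans)
  qed
  moreover have "?u x \<le> sublinear_potential \<beta> q s ?u x" for x
  proof (cases "x \<in> ball 0 R")
    case True
    then have "(2 * R) powr ?e \<le> (norm x + R) powr ?e"
      using \<beta> R by (intro powr_mono2') (auto intro: add_nonneg_pos)
    have "ennreal c = ennreal (c powr q) * m"
      using c \<mu> c_eq by (simp flip: ennreal_mult)
    also have "\<dots> \<le> ennreal (c powr q) * (ennreal ((2 * R) powr ?e) * (\<integral>\<^sup>+y\<in>ball 0 R. s y \<partial>lborel))"
      unfolding m_def by (intro mult_left_mono) auto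
    also have "\<dots> \<le> ennreal (c powr q) * (ennreal ((norm x + R) powr ?e) * (\<integral>\<^sup>+y\<in>ball 0 R. s y \<partial>lborel))"
      by (intro mult_left_mono mult_right_mono ennreal_leI) (fact, auto)
    also note lower
    finally show ?thesis using True by simp
  qed simp
  ultimately show ?thesis using that c by blast
qed

text \<open>
  Monotone iteration from below. The cut-off at level \<open>N k\<close> keeps each iterate bounded with bounded support,
  hence in \<open>L\<^sup>r\<close>, so that the a priori bound applies to it; the levels increase with \<open>k\<close>, which keeps the
  sequence monotone and removes the cut-off in the limit.
\<close>

lemma sublinear_potential_fixed_point:
  fixes \<beta> q r S :: real and s :: "real ^ 'n \<Rightarrow> ennreal"
  assumes q: "0 < q" "q < 1" and \<beta>: "0 < \<beta>" "\<beta> < real CARD('n)"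
    and r: "real CARD('n) / (real CARD('n) - \<beta>) < r"
    and S: "S = real CARD('n) * r / (real CARD('n) * (1 - q) + \<beta> * r)"
    and s [measurable]: "s \<in> borel_measurable borel"
    and s_int: "(\<integral>\<^sup>+x. s x epowr S \<partial>lborel) < \<infinity>"
    and s_nonzero: "(\<integral>\<^sup>+x. s x \<partial>lborel) \<noteq> 0"
  obtains U where "U \<in> borel_measurable borel" "\<And>x. U x = sublinear_potential \<beta> q s U x"
    "\<And>x. 0 < U x" "(\<integral>\<^sup>+x. U x epowr r \<partial>lborel) < \<infinity>"
proof -
  have ball_sets [measurable]: "ball (0 :: real ^ 'n) \<rho> \<in> sets borel" for \<rho> by simp
  have "1 < real CARD('n) / (real CARD('n) - \<beta>)" using \<beta> by simp
  then have r0: "0 < r" using r by linarith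
  have "\<exists>R>0. (\<integral>\<^sup>+y\<in>ball 0 R. s y \<partial>lborel) \<noteq> 0"
  proof (rule ccontr)
    assume none: "\<not> ?thesis"
    have "AE y in lborel. s y * indicator (ball 0 (real (Suc k))) y = 0" for k
    proof -
      have "(\<integral>\<^sup>+y\<in>ball 0 (real (Suc k)). s y \<partial>lborel) = 0" using none by auto
      then show ?thesis by (subst (asm) nn_integral_0_iff_AE) simp_all
    qed
    then have "AE y in lborel. \<forall>k. s y * indicator (ball 0 (real (Suc k))) y = 0"
      unfolding AE_all_countable by blast
    then have "AE y in lborel. s y = 0"
    proof (rule AE_mp, intro AE_I2 impI)
      fix y assume *: "\<forall>k. s y * indicator (ball 0 (real (Suc k))) y = 0"
      obtain k where "norm y < real (Suc k)"
        using reals_Archimedean2[of "norm y"] by (metis less_trans lessI of_nat_less_iff)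
      then show "s y = 0" using *[rule_format, of k] by simp
    qed
    then show False using s_nonzero by (simp add: nn_integral_0_iff_AE)
  qed
  then obtain R where R: "0 < R" "(\<integral>\<^sup>+y\<in>ball 0 R. s y \<partial>lborel) \<noteq> 0" by blast
  obtain c where c: "0 < c" "c \<le> 1"
    and pos: "\<And>x. 0 < sublinear_potential \<beta> q s (\<lambda>y. ennreal c * indicator (ball 0 R) y) x"
    and sub: "\<And>x. ennreal c * indicator (ball 0 R) x
      \<le> sublinear_potential \<beta> q s (\<lambda>y. ennreal c * indicator (ball 0 R) y) x"
    using sublinear_potential_subsolution[OF q \<beta>(2) s R] by blast
  \<comment> \<open>Already the level \<open>N 0 \<ge> max c R\<close> leaves the initial function untouched, so \<open>u 0 \<le> u 1\<close>.\<close>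
  define N where "N k = R + 1 + real k" for k
  define T where "T = sublinear_potential \<beta> q s"
  define u where "u = rec_nat (\<lambda>y. ennreal c * indicator (ball 0 R) y)
    (\<lambda>k v x. min (ennreal (N k)) (T v x) * indicator (ball 0 (N k)) x)"
  have u_0: "u 0 = (\<lambda>y. ennreal c * indicator (ball 0 R) y)"
    and u_Suc: "\<And>k. u (Suc k) = (\<lambda>x. min (ennreal (N k)) (T (u k) x) * indicator (ball 0 (N k)) x)"
    by (simp_all add: u_def)
  have u_meas [measurable]: "u k \<in> borel_measurable borel" for k
    by (induction k) (simp_all add: u_0 u_Suc T_def)
  have T_mono: "T v x \<le> T w x" if "\<And>y. v y \<le> w y" for v w x
    unfolding T_def using q that by (intro sublinear_potential_mono) auto
  have u_le_Suc: "u k x \<le> u (Suc k) x" for k x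
  proof (induction k arbitrary: x)
    case 0
    have "ennreal c \<le> ennreal (N 0)" using c R by (intro ennreal_leI) (simp add: N_def)
    then show ?case
      using sub[of x] unfolding u_Suc by (auto simp: u_0 T_def N_def split: split_indicator)
  next
    case (Suc k)
    have "ennreal (N k) \<le> ennreal (N (Suc k))" by (intro ennreal_leI) (simp add: N_def)
    then have "min (ennreal (N k)) (T (u k) x) \<le> min (ennreal (N (Suc k))) (T (u (Suc k)) x)"
      using T_mono[OF Suc.IH] by (rule min.mono)
    moreover have "indicator (ball 0 (N k)) x \<le> (indicator (ball 0 (N (Suc k))) x :: ennreal)"
      by (auto simp: N_def split: split_indicator)
    ultimately show ?case
      unfolding u_Suc[of "Suc k"] by (subst u_Suc) (intro mult_mono; simp)
  qed
  have u_incseq: "incseq u" by (intro incseq_SucI le_funI u_le_Suc)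
  have u_mono: "u j x \<le> u k x" if "j \<le> k" for j k x
    using monoD[OF u_incseq that] by (simp add: le_fun_def)
  have u_Suc_le: "u (Suc k) x \<le> T (u k) x" for k x
    unfolding u_Suc by (auto split: split_indicator)
  have u_sub: "u k x \<le> T (u k) x" for k x
    using u_le_Suc[of k x] u_Suc_le[of k x] by (rule order_trans)
  have u_fin: "(\<integral>\<^sup>+x. u k x epowr r \<partial>lborel) < \<infinity>" for k
  proof -
    have N: "0 < N k" using R by (simp add: N_def)
    have "u k x epowr r \<le> ennreal (N k powr r) * indicator (ball 0 (N k)) x" for x
    proof -
      have "u k x \<le> ennreal (N k) * indicator (ball 0 (N k)) x"
        using u_le_Suc[of k x] unfolding u_Suc by (auto split: split_indicator)
      then have "u k x epowr r \<le> (ennreal (N k) * indicator (ball 0 (N k)) x) epowr r"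
        using r0 by (rule epowr_mono)
      also have "\<dots> = ennreal (N k powr r) * indicator (ball 0 (N k)) x"
        using N by (auto simp: epowr_ennreal split: split_indicator)
      finally show ?thesis .
    qed
    then have "(\<integral>\<^sup>+x. u k x epowr r \<partial>lborel)
        \<le> (\<integral>\<^sup>+x. ennreal (N k powr r) * indicator (ball (0 :: real ^ 'n) (N k)) x \<partial>lborel)"
      by (intro nn_integral_mono)
    also have "\<dots> < \<infinity>"
      using N by (subst nn_integral_cmult_indicator) (auto simp: emeasure_ball ennreal_mult_less_top)
    finally show ?thesis .
  qed
  obtain K where K: "\<And>v. v \<in> borel_measurable borel \<Longrightarrow> (\<And>x. v x \<le> sublinear_potential \<beta> q s v x) \<Longrightarrow>
      (\<integral>\<^sup>+x. v x epowr r \<partial>lborel) < \<infinity> \<Longrightarrow> (\<integral>\<^sup>+x. v x epowr r \<partial>lborel) \<le> ennreal K"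
    using subsolution_Lp_bound[OF q \<beta> r S s s_int] by blast
  define U where "U x = (SUP k. u k x)" for x
  have U_meas: "U \<in> borel_measurable borel" unfolding U_def by measurable
  have "(\<integral>\<^sup>+x. U x epowr r \<partial>lborel) = (\<integral>\<^sup>+x. (SUP k. u k x epowr r) \<partial>lborel)"
    using r0 by (simp add: U_def epowr_SUP)
  also have "\<dots> = (SUP k. \<integral>\<^sup>+x. u k x epowr r \<partial>lborel)"
    using r0 u_mono
    by (intro nn_integral_monotone_convergence_SUP monoI le_funI epowr_mono) auto
  also have "\<dots> \<le> ennreal K"
    using u_sub u_fin by (intro SUP_least K) (auto simp: T_def)
  finally have U_int: "(\<integral>\<^sup>+x. U x epowr r \<partial>lborel) < \<infinity>"
    by (rule le_less_trans) simp
  have TU: "T U x = (SUP k. T (u k) x)" for x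
    unfolding T_def U_def using q u_incseq by (intro sublinear_potential_SUP) auto
  have U_fix: "U x = T U x" for x
  proof (rule antisym)
    show "U x \<le> T U x"
      unfolding TU U_def using u_sub by (intro SUP_mono) auto
    have "T (u k) x \<le> U x" for k
    proof -
      obtain j where j: "norm x < real j" using reals_Archimedean2 by blast
      \<comment> \<open>For large \<open>m\<close> the point \<open>x\<close> lies in the ball of radius \<open>N m\<close>, and only the cut-off in size is left.\<close>
      have le: "min (ennreal (N m)) (T (u k) x) \<le> U x" if "max j k \<le> m" for m
      proof -
        have "x \<in> ball 0 (N m)" using j that R by (simp add: N_def)
        moreover have "T (u k) x \<le> T (u m) x" using that by (intro T_mono u_mono) simp
        ultimately have "min (ennreal (N m)) (T (u k) x) \<le> u (Suc m) x"
          unfolding u_Suc by (simp add: min.coboundedI2)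
        also have "\<dots> \<le> U x" unfolding U_def by (rule SUP_upper) simp
        finally show ?thesis .
      qed
      show ?thesis
      proof (rule ccontr)
        assume "\<not> ?thesis"
        then have lt: "U x < T (u k) x" by simp
        then obtain b where b: "U x = ennreal b" "0 \<le> b"
          by (cases "U x") auto
        obtain i where i: "b < real i" using reals_Archimedean2 by blast
        define m where "m = max i (max j k)"
        have "ennreal b < ennreal (N m)"
          using i R b by (intro ennreal_lessI) (auto simp: N_def m_def)
        then have "U x < min (ennreal (N m)) (T (u k) x)" using lt b by simp
        also have "\<dots> \<le> U x" by (rule le) (simp add: m_def)
        finally show False by simp
      qed
    qed
    then show "T U x \<le> U x" unfolding TU by (rule SUP_least)
  qed
  have "0 < U x" for x
  proof -
    have "0 < T (u 0) x" using pos by (simp add: u_0 T_def)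
    also have "\<dots> \<le> T U x" unfolding TU by (rule SUP_upper) simp
    finally show ?thesis by (simp flip: U_fix)
  qed
  then show ?thesis using that[of U] U_meas U_fix U_int by (simp add: T_def)
qed

text \<open>
  Since \<open>\<integral> U\<^sup>r\<close> is finite, \<open>U\<close> is finite at some \<open>x\<close>. There \<open>U x\<close> is the potential of \<open>s U\<^sup>q\<close>, and the
  kernel is bounded below on every ball.
\<close>

lemma fixed_point_locally_integrable:
  fixes s :: "real ^ 'n \<Rightarrow> ennreal"
  assumes \<beta>: "\<beta> < real CARD('n)"
    and [measurable]: "s \<in> borel_measurable borel" "U \<in> borel_measurable borel"
    and fix_eq: "\<And>x. U x = sublinear_potential \<beta> q s U x"
    and fin: "(\<integral>\<^sup>+x. U x epowr r \<partial>lborel) < \<infinity>" and K: "compact K"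
  shows "(\<integral>\<^sup>+y\<in>K. (s y * U y epowr q) \<partial>lborel) < \<infinity>"
proof -
  obtain x where x: "U x < \<infinity>"
  proof (rule ccontr)
    assume "\<not> thesis"
    then have "U x = \<infinity>" for x using that[of x] by (metis infinity_ennreal_def top.not_eq_extremum)
    then show False using fin by simp
  qed
  obtain R where R: "0 < R" "K \<subseteq> ball 0 R"
    using bounded_subset_ballD[OF compact_imp_bounded[OF K], of 0] by blast
  have pos: "0 < norm x + R" using R by (simp add: add_nonneg_pos)
  have "ennreal ((norm x + R) powr (\<beta> - real CARD('n)))
      * (\<integral>\<^sup>+y\<in>ball 0 R. (s y * U y epowr q) \<partial>lborel) \<le> U x"
    unfolding fix_eq[of x] sublinear_potential_def
    using \<beta> R by (intro riesz_kernel_integral_lower_bound) auto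
  then have "(\<integral>\<^sup>+y\<in>ball 0 R. (s y * U y epowr q) \<partial>lborel) < \<infinity>"
    using x pos by (auto simp: less_top[symmetric] ennreal_mult_top top_unique)
  moreover have "(\<integral>\<^sup>+y\<in>K. (s y * U y epowr q) \<partial>lborel)
      \<le> (\<integral>\<^sup>+y\<in>ball 0 R. (s y * U y epowr q) \<partial>lborel)"
    using R by (intro nn_integral_mono) (auto split: split_indicator)
  ultimately show ?thesis by (rule le_less_trans[rotated])
qed

theorem corollary1p5:
  fixes \<sigma> :: "real ^ 'n \<Rightarrow> real" and q \<alpha> r s\<^sub>2 n :: real
  assumes "n = real CARD('n)"
    and "0 < q" "q < 1"
    and "0 < \<alpha>" "\<alpha> < n / 2"
    and "n / (n - 2 * \<alpha>) < r"
    and "\<sigma> \<in> borel_measurable lebesgue" "\<And>x. 0 \<le> \<sigma> x"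
    and "weight_measure \<sigma> \<noteq> null_measure lebesgue"
    and "s\<^sub>2 = n * r / (n * (1 - q) + 2 * \<alpha> * r)"
    and "(\<lambda>x. ennreal (\<sigma> x)) \<in> Lp_space s\<^sub>2 lebesgue"
  shows "\<exists>u :: real ^ 'n \<Rightarrow> ennreal.
           frac_laplace_solution \<alpha> q \<sigma> u \<and> (\<forall>x. 0 < u x) \<and> u \<in> Lp_space r lebesgue"
proof -
  note n = assms(1)
  have \<sigma> [measurable]: "(\<lambda>x. ennreal (\<sigma> x)) \<in> borel_measurable lebesgue"
    using assms(7) by measurable
  \<comment> \<open>A Borel version of \<open>\<sigma>\<close>: Tonelli's theorem needs integrands that are jointly measurable for the product of \<open>lborel\<close> with itself. All integrals against \<open>\<sigma>\<close> are unchanged.\<close>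
  obtain s where s_lborel: "s \<in> borel_measurable lborel" and ae: "AE x in lborel. ennreal (\<sigma> x) = s x"
    using completion_ex_borel_measurable[OF \<sigma>] by blast
  then have s [measurable]: "s \<in> borel_measurable borel" by simp
  have replace: "(\<integral>\<^sup>+x. ennreal (\<sigma> x) * g x \<partial>lebesgue) = (\<integral>\<^sup>+x. s x * g x \<partial>lborel)" for g
    unfolding nn_integral_completion using ae by (intro nn_integral_cong_AE) auto
  have "(\<integral>\<^sup>+x. s x epowr s\<^sub>2 \<partial>lborel) = (\<integral>\<^sup>+x. ennreal (\<sigma> x) epowr s\<^sub>2 \<partial>lebesgue)"
    unfolding nn_integral_completion using ae by (intro nn_integral_cong_AE) auto
  then have s_int: "(\<integral>\<^sup>+x. s x epowr s\<^sub>2 \<partial>lborel) < \<infinity>"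
    using assms(11) by (simp add: Lp_space_def)
  have s_nonzero: "(\<integral>\<^sup>+x. s x \<partial>lborel) \<noteq> 0"
  proof
    assume zero: "(\<integral>\<^sup>+x. s x \<partial>lborel) = 0"
    have "weight_measure \<sigma> = null_measure lebesgue"
    proof (rule measure_eqI)
      fix X assume "X \<in> sets (weight_measure \<sigma>)"
      then have X: "X \<in> sets lebesgue" by (simp add: weight_measure_def)
      have "emeasure (weight_measure \<sigma>) X = (\<integral>\<^sup>+x. ennreal (\<sigma> x) * indicator X x \<partial>lebesgue)"
        unfolding weight_measure_def using X by (intro emeasure_density) measurable
      also have "\<dots> \<le> (\<integral>\<^sup>+x. s x \<partial>lborel)"
        unfolding replace by (intro nn_integral_mono) (simp split: split_indicator)
      finally show "emeasure (weight_measure \<sigma>) X = emeasure (null_measure lebesgue) X"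
        using zero by simp
    qed (simp add: weight_measure_def)
    then show False using assms(9) by simp
  qed
  have \<alpha>: "0 < 2 * \<alpha>" "2 * \<alpha> < real CARD('n)" using assms by auto
  obtain U where U [measurable]: "U \<in> borel_measurable borel"
    and U_fix: "\<And>x. U x = sublinear_potential (2 * \<alpha>) q s U x"
    and U_pos: "\<And>x. 0 < U x" and U_int: "(\<integral>\<^sup>+x. U x epowr r \<partial>lborel) < \<infinity>"
    using sublinear_potential_fixed_point[OF assms(2,3) \<alpha> assms(6)[unfolded n]
        assms(10)[unfolded n] s s_int s_nonzero] by blast
  have lebesgue_meas: "f \<in> borel_measurable lebesgue" if "f \<in> borel_measurable borel"
    for f :: "real ^ 'n \<Rightarrow> ennreal"
    using that by (simp add: measurable_completion)
  have weight_integral: "(\<integral>\<^sup>+x. g x \<partial>weight_measure \<sigma>) = (\<integral>\<^sup>+x. s x * g x \<partial>lborel)"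
    if "g \<in> borel_measurable borel" for g
    unfolding weight_measure_def replace[symmetric]
    using lebesgue_meas[OF that] by (intro nn_integral_density) auto
  have "U \<in> Lp_loc_space q (weight_measure \<sigma>)"
    unfolding Lp_loc_space_def
  proof (intro CollectI conjI allI impI)
    show "U \<in> borel_measurable (weight_measure \<sigma>)"
      using lebesgue_meas[OF U] by (simp add: weight_measure_def)
    fix K :: "(real ^ 'n) set" assume K: "compact K"
    then have [measurable]: "K \<in> sets borel" by (simp add: borel_compact)
    have "(\<integral>\<^sup>+x\<in>K. U x epowr q \<partial>weight_measure \<sigma>) = (\<integral>\<^sup>+x\<in>K. (s x * U x epowr q) \<partial>lborel)"
      by (subst weight_integral) (simp_all add: mult.assoc)
    then show "(\<integral>\<^sup>+x\<in>K. U x epowr q \<partial>weight_measure \<sigma>) < \<infinity>"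
      using fixed_point_locally_integrable[OF \<alpha>(2) s U U_fix U_int K] by simp
  qed
  moreover have "U x = riesz_potential (2 * \<alpha>)
      (density (weight_measure \<sigma>) (\<lambda>y. U y epowr q)) x" for x
  proof -
    have [measurable]: "f \<in> borel_measurable (weight_measure \<sigma>)" if "f \<in> borel_measurable borel"
      for f :: "real ^ 'n \<Rightarrow> ennreal"
      using lebesgue_meas[OF that] by (simp add: weight_measure_def)
    have "riesz_potential (2 * \<alpha>) (density (weight_measure \<sigma>) (\<lambda>y. U y epowr q)) x
        = (\<integral>\<^sup>+y. U y epowr q * riesz_kernel (2 * \<alpha>) x y \<partial>weight_measure \<sigma>)"
      unfolding riesz_potential_def by (rule nn_integral_density) measurable
    also have "\<dots> = (\<integral>\<^sup>+y. s y * (U y epowr q * riesz_kernel (2 * \<alpha>) x y) \<partial>lborel)"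
      by (rule weight_integral) measurable
    also have "\<dots> = sublinear_potential (2 * \<alpha>) q s U x"
      unfolding sublinear_potential_def by (simp only: mult_ac)
    finally show ?thesis using U_fix by simp
  qed
  moreover have "Liminf at_infinity U = 0"
  proof (rule Liminf_at_infinity_eq_0[OF _ U_int])
    have "1 < n / (n - 2 * \<alpha>)" using \<alpha> n by simp
    then show "0 < r" using assms(6) by linarith
  qed
  moreover have "U \<in> Lp_space r lebesgue"
    unfolding Lp_space_def using lebesgue_meas[OF U] U_int by (simp add: nn_integral_completion)
  ultimately show ?thesis
    unfolding frac_laplace_solution_def using U_pos by blast
qed

end
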